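(* Let $G$ be a simple graph on $\{1,\dots,n\}$, let $U$ be a smooth convex function with $U'$ strictly increasing on $(0,\infty)$, let $E(p)=\sum_{i=1}^nU(p_i)$, and for each edge $ij$ let $\theta_{ij}=\frac{p_i-p_j}{U'(p_i)-U'(p_j)}$ (and $\theta_{ij}=0$ for non-edges and $i=j$). Define, for $f\in\mathbb{R}^n$, $\Gamma_1(p,f,f)=\sum_{i,j=1}^n\theta_{ij}(f_i-f_j)^2$ and $$\Gamma_2(p,f,f)=\frac12\sum_{i,j,k=1}^n (f_i-f_j)^2\left(\frac{\partial\theta_{ij}}{\partial p_i}\eta_{ki}+\frac{\partial\eta_{ij}}{\partial p_i}\theta_{ki}+\frac{\partial\eta_{jk}}{\partial p_j}\theta_{ij}-\frac{\partial\eta_{ki}}{\partial p_k}\theta_{jk}\right),\quad \eta_{ij}=\theta_{ij}(U'(p_i)-U'(p_j)).$$ Assume there is a constant $m>0$ with $$\frac1m=\min_{p}\frac{\Gamma_2(p,\nabla_pE(p),\nabla_pE(p))}{\Gamma_1(p,\nabla_pE(p),\nabla_pE(p))^2},$$ the minimum over the probability simplex, and let $N(p)=e^{-\frac2mE(p)}$. If $p(t)$ (with values in the interior of the probability simplex) solves the discrete heat equation $$\frac{dp_i}{dt}=\frac12\sum_{j:\,ij\in E(G)}(p_j-p_i),\qquad i=1,\dots,n,$$ then $\frac{d^2}{dt^2}N(p(t))\le0$ for all $t\ge0$.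
   Context: $\nabla_pE(p)=(U'(p_1),\dots,U'(p_n))$. Partial derivatives of $\theta_{ij}$ and $\eta_{ij}$ are taken with these viewed as functions of $p\in(0,\infty)^n$. *)

theory Defs
  imports "HOL-Analysis.Analysis"
begin

text \<open>The vertex set \<open>{1,\<dots>,n}\<close> is the finite index type \<open>'n\<close>, and \<open>\<real>\<^sup>n\<close> is \<open>real ^ 'n\<close>.\<close>

definition simple_graph :: "('n \<Rightarrow> 'n \<Rightarrow> bool) \<Rightarrow> bool" where
  "simple_graph adj \<longleftrightarrow> symp adj \<and> irreflp adj"

definition smooth_on_pos :: "(real \<Rightarrow> real) \<Rightarrow> bool" where
  "smooth_on_pos U \<longleftrightarrow> (\<forall>k. \<forall>x>0. ((deriv ^^ k) U) field_differentiable (at x))"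

definition prob_simplex :: "(real ^ 'n) set" where
  "prob_simplex = {p. (\<forall>i. 0 \<le> p $ i) \<and> (\<Sum>i\<in>UNIV. p $ i) = 1}"

text \<open>The interior is taken relative to the hyperplane \<open>\<Sum>\<^sub>i p\<^sub>i = 1\<close>.\<close>

definition interior_simplex :: "(real ^ 'n) set" where
  "interior_simplex = {p. (\<forall>i. 0 < p $ i) \<and> (\<Sum>i\<in>UNIV. p $ i) = 1}"

definition partial_deriv :: "'n \<Rightarrow> (real ^ 'n \<Rightarrow> real) \<Rightarrow> real ^ 'n \<Rightarrow> real" where
  "partial_deriv i F p = deriv (\<lambda>s. F (\<chi> k. if k = i then s else p $ k)) (p $ i)"

definition energy :: "(real \<Rightarrow> real) \<Rightarrow> real ^ 'n \<Rightarrow> real" where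
  "energy U p = (\<Sum>i\<in>UNIV. U (p $ i))"

definition grad_energy :: "(real \<Rightarrow> real) \<Rightarrow> real ^ 'n \<Rightarrow> real ^ 'n" where
  "grad_energy U p = (\<chi> i. deriv U (p $ i))"

text \<open>Where \<open>p\<^sub>i = p\<^sub>j\<close> the difference quotient reads \<open>0/0\<close>, and \<open>\<theta>\<^sub>i\<^sub>j\<close> is given its limit
  \<open>1 / U''(p\<^sub>i)\<close> there.\<close>

definition theta ::
  "('n \<Rightarrow> 'n \<Rightarrow> bool) \<Rightarrow> (real \<Rightarrow> real) \<Rightarrow> 'n \<Rightarrow> 'n \<Rightarrow> real ^ 'n \<Rightarrow> real" where
  "theta adj U i j p =
    (if adj i j then
       if p $ i = p $ j then 1 / deriv (deriv U) (p $ i)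
       else (p $ i - p $ j) / (deriv U (p $ i) - deriv U (p $ j))
     else 0)"

definition eta ::
  "('n \<Rightarrow> 'n \<Rightarrow> bool) \<Rightarrow> (real \<Rightarrow> real) \<Rightarrow> 'n \<Rightarrow> 'n \<Rightarrow> real ^ 'n \<Rightarrow> real" where
  "eta adj U i j p = theta adj U i j p * (deriv U (p $ i) - deriv U (p $ j))"

text \<open>\<open>Gamma1 adj U p f\<close> and \<open>Gamma2 adj U p f\<close> stand for \<open>\<Gamma>\<^sub>1(p,f,f)\<close> and \<open>\<Gamma>\<^sub>2(p,f,f)\<close>.\<close>

definition Gamma1 ::
  "('n \<Rightarrow> 'n \<Rightarrow> bool) \<Rightarrow> (real \<Rightarrow> real) \<Rightarrow> real ^ 'n \<Rightarrow> real ^ 'n \<Rightarrow> real" where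
  "Gamma1 adj U p f = (\<Sum>i\<in>UNIV. \<Sum>j\<in>UNIV. theta adj U i j p * (f $ i - f $ j)\<^sup>2)"

definition Gamma2 ::
  "('n \<Rightarrow> 'n \<Rightarrow> bool) \<Rightarrow> (real \<Rightarrow> real) \<Rightarrow> real ^ 'n \<Rightarrow> real ^ 'n \<Rightarrow> real" where
  "Gamma2 adj U p f =
    1 / 2 * (\<Sum>i\<in>UNIV. \<Sum>j\<in>UNIV. \<Sum>k\<in>UNIV. (f $ i - f $ j)\<^sup>2 *
      (partial_deriv i (theta adj U i j) p * eta adj U k i p
       + partial_deriv i (eta adj U i j) p * theta adj U k i p
       + partial_deriv j (eta adj U j k) p * theta adj U i j p
       - partial_deriv k (eta adj U k i) p * theta adj U j k p))"

definition Gamma_ratio ::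
  "('n \<Rightarrow> 'n \<Rightarrow> bool) \<Rightarrow> (real \<Rightarrow> real) \<Rightarrow> real ^ 'n \<Rightarrow> real" where
  "Gamma_ratio adj U p =
    Gamma2 adj U p (grad_energy U p) / (Gamma1 adj U p (grad_energy U p))\<^sup>2"

text \<open>The quotient is undefined where \<open>\<Gamma>\<^sub>1\<close> vanishes, for instance at the uniform distribution.
  These points have to be left out of the minimum: HOL evaluates the quotient to \<open>0\<close> there,
  so that no minimum could be positive.\<close>

definition Gamma_ratio_dom ::
  "('n \<Rightarrow> 'n \<Rightarrow> bool) \<Rightarrow> (real \<Rightarrow> real) \<Rightarrow> (real ^ 'n) set" where
  "Gamma_ratio_dom adj U = {p \<in> interior_simplex. Gamma1 adj U p (grad_energy U p) \<noteq> 0}"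

text \<open>\<open>U\<close> and its derivatives are only given on \<open>(0,\<infinity>)\<close>. At a boundary point of the simplex the
  quotient has as its value the limit from the interior, if a finite limit exists.\<close>

definition has_Gamma_ratio ::
  "('n \<Rightarrow> 'n \<Rightarrow> bool) \<Rightarrow> (real \<Rightarrow> real) \<Rightarrow> real ^ 'n \<Rightarrow> real \<Rightarrow> bool" where
  "has_Gamma_ratio adj U p v \<longleftrightarrow>
    (p \<in> Gamma_ratio_dom adj U \<and> v = Gamma_ratio adj U p) \<or>
    (p \<in> prob_simplex - interior_simplex \<and> p \<in> closure (Gamma_ratio_dom adj U) \<and>
     (Gamma_ratio adj U \<longlongrightarrow> v) (at p within Gamma_ratio_dom adj U))"

definition is_min_Gamma_ratio ::
  "('n::finite \<Rightarrow> 'n \<Rightarrow> bool) \<Rightarrow> (real \<Rightarrow> real) \<Rightarrow> real \<Rightarrow> bool" where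
  "is_min_Gamma_ratio adj U c \<longleftrightarrow>
    (\<exists>p \<in> prob_simplex. has_Gamma_ratio adj U p c) \<and>
    (\<forall>p \<in> prob_simplex. \<forall>v. has_Gamma_ratio adj U p v \<longrightarrow> c \<le> v)"

definition entropy_power :: "real \<Rightarrow> (real \<Rightarrow> real) \<Rightarrow> real ^ 'n \<Rightarrow> real" where
  "entropy_power m U p = exp (- (2 / m) * energy U p)"

definition heat_solution :: "('n \<Rightarrow> 'n \<Rightarrow> bool) \<Rightarrow> (real \<Rightarrow> real ^ 'n) \<Rightarrow> bool" where
  "heat_solution adj p \<longleftrightarrow>
    (\<forall>t\<ge>0. \<forall>i. ((\<lambda>s. p s $ i) has_real_derivative
        1 / 2 * (\<Sum>j | adj i j. p t $ j - p t $ i)) (at t within {0..}))"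

end

theory Submission
  imports Defs
begin

text \<open>Let \<open>L\<close> be the graph Laplacian and \<open>f = U'(p)\<close>. On positive \<open>p\<close> the flux \<open>\<eta>\<^sub>i\<^sub>j\<close> is linear,
  \<open>\<eta>\<^sub>i\<^sub>j = p\<^sub>i - p\<^sub>j\<close> on edges, so the heat equation is the gradient flow \<open>p' = - L p / 2\<close> and
  \<open>\<Gamma>\<^sub>1 = 2 \<langle>f, L p\<rangle>\<close>, whence \<open>E' = - \<Gamma>\<^sub>1 / 4\<close>. Polarisation of the last three terms of \<open>\<Gamma>\<^sub>2\<close> gives
  \<open>2 \<Gamma>\<^sub>2 = \<langle>L f, L p\<rangle> + \<Sum>\<^sub>i U''(p\<^sub>i) (L p)\<^sub>i\<^sup>2 = - \<Gamma>\<^sub>1'\<close>. Hence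
  \<open>N'' = (\<Gamma>\<^sub>1\<^sup>2 / m - 4 \<Gamma>\<^sub>2) N / (4 m)\<close>, and \<open>\<Gamma>\<^sub>1\<^sup>2 / m \<le> \<Gamma>\<^sub>2\<close> holds by the choice of \<open>m\<close>, or because
  \<open>L p = 0\<close> where \<open>\<Gamma>\<^sub>1 = 0\<close>.\<close>

section \<open>Graph Laplacian, with the positive semidefinite sign, and summation by parts\<close>

definition laplacian :: "('n::finite \<Rightarrow> 'n \<Rightarrow> bool) \<Rightarrow> ('n \<Rightarrow> real) \<Rightarrow> 'n \<Rightarrow> real" where
  "laplacian adj x i = (\<Sum>j\<in>UNIV. of_bool (adj i j) * (x i - x j))"

text \<open>Interchanging i and j flips the sign of y i - y j, so by symmetry of \<open>adj\<close>
  the part with x j is minus the part with x i.\<close>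

lemma laplacian_dirichlet_form:
  assumes "symp adj"
  shows "(\<Sum>i\<in>UNIV. \<Sum>j\<in>UNIV. of_bool (adj i j) * ((x i - x j) * (y i - y j)))
    = 2 * (\<Sum>i\<in>UNIV. x i * laplacian adj y i)"
proof -
  have "(\<Sum>i\<in>UNIV. \<Sum>j\<in>UNIV. of_bool (adj i j) * (x j * (y i - y j)))
      = (\<Sum>i\<in>UNIV. \<Sum>j\<in>UNIV. of_bool (adj j i) * (x i * (y j - y i)))"
    by (rule sum.swap)
  also have "\<dots> = (\<Sum>i\<in>UNIV. \<Sum>j\<in>UNIV. - (x i * (of_bool (adj i j) * (y i - y j))))"
    using sympD[OF assms]
    by (intro sum.cong refl) (auto simp: algebra_simps of_bool_def)
  also have "\<dots> = - (\<Sum>i\<in>UNIV. x i * laplacian adj y i)"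
    by (simp only: laplacian_def sum_distrib_left sum_negf)
  finally have "(\<Sum>i\<in>UNIV. \<Sum>j\<in>UNIV. of_bool (adj i j) * (x j * (y i - y j)))
      = - (\<Sum>i\<in>UNIV. x i * laplacian adj y i)" .
  moreover have "(\<Sum>i\<in>UNIV. \<Sum>j\<in>UNIV. of_bool (adj i j) * (x i * (y i - y j)))
      = (\<Sum>i\<in>UNIV. x i * laplacian adj y i)"
    unfolding laplacian_def sum_distrib_left by (intro sum.cong refl) simp
  moreover have "of_bool (adj i j) * ((x i - x j) * (y i - y j))
      = of_bool (adj i j) * (x i * (y i - y j)) - of_bool (adj i j) * (x j * (y i - y j))" for i j
    by (simp add: algebra_simps)
  ultimately show ?thesis
    by (simp add: sum_subtractf)
qed

lemma laplacian_selfadjoint: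
  assumes "symp adj"
  shows "(\<Sum>i\<in>UNIV. x i * laplacian adj y i) = (\<Sum>i\<in>UNIV. y i * laplacian adj x i)"
  using laplacian_dirichlet_form[OF assms, of x y] laplacian_dirichlet_form[OF assms, of y x]
  by (simp add: mult.commute)

lemma laplacian_scale: "laplacian adj (\<lambda>i. c * x i) i = c * laplacian adj x i"
  by (simp add: laplacian_def sum_distrib_left algebra_simps)

text \<open>Serves to bring the cyclically permuted coefficients in \<open>Gamma2\<close> to one
  common form.\<close>

lemma sum_rotate3:
  fixes g :: "'a \<Rightarrow> 'a \<Rightarrow> 'a \<Rightarrow> 'b::comm_monoid_add"
  shows "(\<Sum>i\<in>A. \<Sum>j\<in>A. \<Sum>k\<in>A. g j k i) = (\<Sum>i\<in>A. \<Sum>j\<in>A. \<Sum>k\<in>A. g i j k)"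
proof -
  have "(\<Sum>i\<in>A. \<Sum>j\<in>A. \<Sum>k\<in>A. g j k i) = (\<Sum>j\<in>A. \<Sum>i\<in>A. \<Sum>k\<in>A. g j k i)"
    by (rule sum.swap)
  also have "\<dots> = (\<Sum>j\<in>A. \<Sum>k\<in>A. \<Sum>i\<in>A. g j k i)"
    by (intro sum.cong refl sum.swap)
  finally show ?thesis .
qed

section \<open>Fluxes, edge weights and their partial derivatives\<close>

locale strictly_convex_energy =
  fixes adj :: "'n::finite \<Rightarrow> 'n \<Rightarrow> bool" and U :: "real \<Rightarrow> real"
  assumes simple: "simple_graph adj"
    and smooth: "smooth_on_pos U"
    and strict: "strict_mono_on {0<..} (deriv U)"
begin

lemma symp_adj: "symp adj" and not_adj_self: "\<not> adj i i"
  using simple by (auto simp: simple_graph_def irreflp_def)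

lemma deriv_U_eq_iff: "0 < x \<Longrightarrow> 0 < y \<Longrightarrow> deriv U x = deriv U y \<longleftrightarrow> x = y"
  using strict_mono_on_eqD[OF strict] by fastforce

lemma DERIV_U: "0 < x \<Longrightarrow> (U has_real_derivative deriv U x) (at x)"
  using smooth unfolding smooth_on_pos_def
  by (metis DERIV_deriv_iff_field_differentiable funpow_0)

lemma DERIV_deriv_U: "0 < x \<Longrightarrow> (deriv U has_real_derivative deriv (deriv U) x) (at x)"
  using smooth unfolding smooth_on_pos_def
  by (metis DERIV_deriv_iff_field_differentiable funpow_0 funpow.simps(2) o_apply)

text \<open>For distinct coordinates the denominator of \<open>theta\<close> cancels, being nonzero
  as U' is injective on positive reals. For equal ones the factor U'(p_i) - U'(p_j) is zero,
  whatever value \<open>theta\<close> has there.\<close>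

lemma eta_eq:
  assumes "0 < p $ i" "0 < p $ j"
  shows "eta adj U i j p = of_bool (adj i j) * (p $ i - p $ j)"
  using deriv_U_eq_iff[OF assms] by (auto simp: eta_def theta_def)

lemma partial_deriv_eta:
  assumes pos: "\<And>i. 0 < p $ i"
  shows "partial_deriv i (eta adj U i j) p = of_bool (adj i j)"
proof (cases "i = j")
  case True
  then show ?thesis
    by (simp add: partial_deriv_def eta_def theta_def not_adj_self)
next
  case False
  \<comment> \<open>Linearity of \<open>eta\<close> is known at positive coordinates only, so the
    derivative is read off from a neighbourhood.\<close>
  have "\<forall>\<^sub>F s in nhds (p $ i). (0::real) < s"
    using pos by (intro eventually_nhds_in_open[of "{0<..}", simplified]) auto
  then have "\<forall>\<^sub>F s in nhds (p $ i). eta adj U i j (\<chi> k. if k = i then s else p $ k)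
      = of_bool (adj i j) * (s - p $ j)"
    by eventually_elim (use pos False in \<open>subst eta_eq, auto\<close>)
  moreover have "((\<lambda>s. of_bool (adj i j) * (s - p $ j)) has_real_derivative of_bool (adj i j))
      (at (p $ i))"
    by (auto intro!: derivative_eq_intros)
  ultimately show ?thesis
    unfolding partial_deriv_def by (rule trans[OF deriv_cong_ev[OF _ refl] DERIV_imp_deriv])
qed

text \<open>Multiplying by the squared difference makes the quotient rule valid at p_i = p_j as
  well: both sides vanish there, so no derivative of \<open>theta\<close> on the diagonal is needed,
  where U'' may even be zero.\<close>

lemma partial_deriv_theta:
  assumes pos: "\<And>i. 0 < p $ i"
  shows "(deriv U (p $ i) - deriv U (p $ j))\<^sup>2 * partial_deriv i (theta adj U i j) p
    = of_bool (adj i j) * (deriv U (p $ i) - deriv U (p $ j)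
        - (p $ i - p $ j) * deriv (deriv U) (p $ i))"
proof (cases "p $ i = p $ j \<or> \<not> adj i j")
  case True
  then show ?thesis
    by (auto simp: partial_deriv_def theta_def)
next
  case False
  then have ne: "p $ i \<noteq> p $ j" and "adj i j" and "i \<noteq> j"
    by auto
  have fne: "deriv U (p $ i) \<noteq> deriv U (p $ j)"
    using deriv_U_eq_iff pos ne by blast
  have "\<forall>\<^sub>F s in nhds (p $ i). s \<noteq> p $ j"
    using ne by (intro eventually_nhds_in_open[of "- {p $ j}", simplified]) auto
  then have "\<forall>\<^sub>F s in nhds (p $ i). theta adj U i j (\<chi> k. if k = i then s else p $ k)
      = (s - p $ j) / (deriv U s - deriv U (p $ j))"
    by eventually_elim (use \<open>adj i j\<close> \<open>i \<noteq> j\<close> in \<open>simp add: theta_def\<close>)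
  moreover have "((\<lambda>s. (s - p $ j) / (deriv U s - deriv U (p $ j))) has_real_derivative
      (deriv U (p $ i) - deriv U (p $ j) - (p $ i - p $ j) * deriv (deriv U) (p $ i))
        / (deriv U (p $ i) - deriv U (p $ j))\<^sup>2) (at (p $ i))"
    by (rule DERIV_cong[OF DERIV_divide[OF DERIV_diff[OF DERIV_ident DERIV_const]
            DERIV_diff[OF DERIV_deriv_U[OF pos] DERIV_const]]])
      (use fne in \<open>simp_all add: power2_eq_square\<close>)
  ultimately have "partial_deriv i (theta adj U i j) p =
      (deriv U (p $ i) - deriv U (p $ j) - (p $ i - p $ j) * deriv (deriv U) (p $ i))
        / (deriv U (p $ i) - deriv U (p $ j))\<^sup>2"
    unfolding partial_deriv_def by (rule trans[OF deriv_cong_ev[OF _ refl] DERIV_imp_deriv])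
  then show ?thesis
    using fne \<open>adj i j\<close> by simp
qed

section \<open>The Gamma operators at the gradient of the energy\<close>

lemma Gamma1_grad_energy_double_sum:
  assumes pos: "\<And>i. 0 < p $ i"
  shows "Gamma1 adj U p (grad_energy U p) = (\<Sum>i\<in>UNIV. \<Sum>j\<in>UNIV. of_bool (adj i j) *
    ((deriv U (p $ i) - deriv U (p $ j)) * (p $ i - p $ j)))"
  unfolding Gamma1_def grad_energy_def
proof (intro sum.cong refl)
  fix i j
  show "theta adj U i j p * ((\<chi> i. deriv U (p $ i)) $ i - (\<chi> i. deriv U (p $ i)) $ j)\<^sup>2
    = of_bool (adj i j) * ((deriv U (p $ i) - deriv U (p $ j)) * (p $ i - p $ j))"
    \<comment> \<open>One factor of the square turns \<open>theta\<close> into \<open>eta\<close>;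
      the other one remains.\<close>
    using eta_eq[OF pos pos, of i j] unfolding eta_def vec_lambda_beta by algebra
qed

lemma Gamma1_grad_energy:
  assumes pos: "\<And>i. 0 < p $ i"
  shows "Gamma1 adj U p (grad_energy U p)
    = 2 * (\<Sum>i\<in>UNIV. deriv U (p $ i) * laplacian adj (($) p) i)"
  unfolding Gamma1_grad_energy_double_sum[OF pos]
  using laplacian_dirichlet_form[OF symp_adj, of "\<lambda>i. deriv U (p $ i)" "($) p"] by simp

text \<open>All terms of the double sum are nonnegative by monotonicity of U', so each one vanishes,
  and injectivity of U' makes p constant along every edge.\<close>

lemma laplacian_eq_0_if_Gamma1_eq_0:
  assumes pos: "\<And>i. 0 < p $ i"
    and "Gamma1 adj U p (grad_energy U p) = 0"
  shows "laplacian adj (($) p) i = 0"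
proof -
  define g where "g i j = of_bool (adj i j) *
    ((deriv U (p $ i) - deriv U (p $ j)) * (p $ i - p $ j))" for i j
  have "0 \<le> (deriv U (p $ i) - deriv U (p $ j)) * (p $ i - p $ j)" for i j
    using strict_mono_onD[OF strict, of "p $ i" "p $ j"]
      strict_mono_onD[OF strict, of "p $ j" "p $ i"] pos
    by (cases "p $ i" "p $ j" rule: linorder_cases)
      (auto intro: mult_nonneg_nonneg mult_nonpos_nonpos)
  then have nonneg: "0 \<le> g i j" for i j
    by (simp add: g_def)
  have "(\<Sum>i\<in>UNIV. \<Sum>j\<in>UNIV. g i j) = 0"
    using assms(2) unfolding Gamma1_grad_energy_double_sum[OF pos] g_def .
  then have "g i j = 0" for i j
    by (simp add: sum_nonneg_eq_0_iff sum_nonneg nonneg)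
  then have "of_bool (adj i j) * (p $ i - p $ j) = 0" for j
    using deriv_U_eq_iff[OF pos pos] by (auto simp: g_def)
  then show ?thesis
    unfolding laplacian_def by (intro sum.neutral) blast
qed

lemma Gamma2_grad_energy:
  assumes pos: "\<And>i. 0 < p $ i"
  shows "2 * Gamma2 adj U p (grad_energy U p)
    = (\<Sum>i\<in>UNIV. laplacian adj (\<lambda>i. deriv U (p $ i)) i * laplacian adj (($) p) i)
      + (\<Sum>i\<in>UNIV. deriv (deriv U) (p $ i) * (laplacian adj (($) p) i)\<^sup>2)"
proof -
  define f where "f i = deriv U (p $ i)" for i
  define u where "u i = deriv (deriv U) (p $ i)" for i
  define a :: "'n \<Rightarrow> 'n \<Rightarrow> real" where "a i j = of_bool (adj i j)" for i j
  \<comment> \<open>The last three terms of \<open>Gamma2\<close> have the coefficients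
    \<open>F i j k\<close>, \<open>F j k i\<close> and \<open>F k i j\<close>; rotating the indices
    makes all of them \<open>F i j k\<close>.\<close>
  define F where "F i j k = a i j * theta adj U k i p" for i j k
  have a_commute: "a i j = a j i" for i j
    using sympD[OF symp_adj] by (auto simp: a_def of_bool_def)
  have lap: "laplacian adj x i = (\<Sum>j\<in>UNIV. a i j * (x i - x j))" for x i
    by (simp add: laplacian_def a_def)
  have "2 * Gamma2 adj U p (grad_energy U p) = (\<Sum>i\<in>UNIV. \<Sum>j\<in>UNIV. \<Sum>k\<in>UNIV.
      a i j * (f i - f j - (p $ i - p $ j) * u i) * (a i k * (p $ k - p $ i))
      + F i j k * (f i - f j)\<^sup>2 + F j k i * (f i - f j)\<^sup>2 - F k i j * (f i - f j)\<^sup>2)"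
    (is "_ = (\<Sum>i\<in>_. \<Sum>j\<in>_. \<Sum>k\<in>_. ?A i j k + _ + _ - _)")
    unfolding Gamma2_def grad_energy_def
  proof (simp add: partial_deriv_eta[OF pos] eta_eq[OF pos pos], intro sum.cong refl)
    fix i j k
    show "(deriv U (p $ i) - deriv U (p $ j))\<^sup>2 *
        (partial_deriv i (theta adj U i j) p * (of_bool (adj k i) * (p $ k - p $ i))
         + of_bool (adj i j) * theta adj U k i p + of_bool (adj j k) * theta adj U i j p
         - of_bool (adj k i) * theta adj U j k p)
      = ?A i j k + F i j k * (f i - f j)\<^sup>2 + F j k i * (f i - f j)\<^sup>2 - F k i j * (f i - f j)\<^sup>2"
      using partial_deriv_theta[OF pos, of i j]
      unfolding F_def f_def[symmetric] u_def[symmetric] a_def[symmetric] a_commute[of k i]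
      by algebra
  qed
  also have "\<dots> = (\<Sum>i\<in>UNIV. \<Sum>j\<in>UNIV. \<Sum>k\<in>UNIV. ?A i j k)
      + (\<Sum>i\<in>UNIV. \<Sum>j\<in>UNIV. \<Sum>k\<in>UNIV. F i j k * (f i - f j)\<^sup>2)
      + (\<Sum>i\<in>UNIV. \<Sum>j\<in>UNIV. \<Sum>k\<in>UNIV. F j k i * (f i - f j)\<^sup>2)
      - (\<Sum>i\<in>UNIV. \<Sum>j\<in>UNIV. \<Sum>k\<in>UNIV. F k i j * (f i - f j)\<^sup>2)"
    by (simp only: sum.distrib sum_subtractf)
  also have "(\<Sum>i\<in>UNIV. \<Sum>j\<in>UNIV. \<Sum>k\<in>UNIV. F j k i * (f i - f j)\<^sup>2)
      = (\<Sum>i\<in>UNIV. \<Sum>j\<in>UNIV. \<Sum>k\<in>UNIV. F i j k * (f k - f i)\<^sup>2)"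
    by (rule sum_rotate3)
  also have "(\<Sum>i\<in>UNIV. \<Sum>j\<in>UNIV. \<Sum>k\<in>UNIV. F k i j * (f i - f j)\<^sup>2)
      = (\<Sum>i\<in>UNIV. \<Sum>j\<in>UNIV. \<Sum>k\<in>UNIV. F i j k * (f j - f k)\<^sup>2)"
    by (rule sum_rotate3[symmetric])
  also have "(\<Sum>i\<in>UNIV. \<Sum>j\<in>UNIV. \<Sum>k\<in>UNIV. ?A i j k)
      + (\<Sum>i\<in>UNIV. \<Sum>j\<in>UNIV. \<Sum>k\<in>UNIV. F i j k * (f i - f j)\<^sup>2)
      + (\<Sum>i\<in>UNIV. \<Sum>j\<in>UNIV. \<Sum>k\<in>UNIV. F i j k * (f k - f i)\<^sup>2)
      - (\<Sum>i\<in>UNIV. \<Sum>j\<in>UNIV. \<Sum>k\<in>UNIV. F i j k * (f j - f k)\<^sup>2)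
    = (\<Sum>i\<in>UNIV. \<Sum>j\<in>UNIV. \<Sum>k\<in>UNIV. ?A i j k
        + F i j k * (f i - f j)\<^sup>2 + F i j k * (f k - f i)\<^sup>2 - F i j k * (f j - f k)\<^sup>2)"
    by (simp only: sum.distrib sum_subtractf)
  also have "\<dots> = (\<Sum>i\<in>UNIV. \<Sum>j\<in>UNIV. \<Sum>k\<in>UNIV.
      a i j * (f i - f j) * (a i k * (p $ i - p $ k))
      + u i * (a i j * (p $ i - p $ j) * (a i k * (p $ i - p $ k))))"
  proof (intro sum.cong refl)
    fix i j k
    \<comment> \<open>The three squares combine to -2 (f_i - f_j) (f_k - f_i), and
      \<open>theta\<close> absorbs the second factor. Of the two copies thus obtained,
      \<open>?A\<close> cancels one and contributes the term with U''.\<close>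
    have "theta adj U k i p * (f k - f i) = a i k * (p $ k - p $ i)"
      using eta_eq[OF pos pos, of k i] unfolding eta_def f_def
      by (simp add: a_commute[of i k]) (simp add: a_def)
    then show "?A i j k
        + F i j k * (f i - f j)\<^sup>2 + F i j k * (f k - f i)\<^sup>2 - F i j k * (f j - f k)\<^sup>2
      = a i j * (f i - f j) * (a i k * (p $ i - p $ k))
        + u i * (a i j * (p $ i - p $ j) * (a i k * (p $ i - p $ k)))"
      unfolding F_def by algebra
  qed
  also have "\<dots> = (\<Sum>i\<in>UNIV. laplacian adj f i * laplacian adj (($) p) i)
      + (\<Sum>i\<in>UNIV. u i * (laplacian adj (($) p) i)\<^sup>2)"
    unfolding sum.distrib power2_eq_square lap sum_product unfolding sum_distrib_left ..
  finally show ?thesis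
    unfolding f_def u_def .
qed

end

section \<open>Concavity of the entropy power along the heat flow\<close>

theorem mainTheorem10:
  fixes adj :: "'n::finite \<Rightarrow> 'n \<Rightarrow> bool"
    and U :: "real \<Rightarrow> real"
    and m :: real
    and p :: "real \<Rightarrow> real ^ 'n"
  assumes "simple_graph adj"
    and "smooth_on_pos U"
    and "convex_on {0<..} U"
    and "strict_mono_on {0<..} (deriv U)"
    and "m > 0"
    and "is_min_Gamma_ratio adj U (1 / m)"
    and "\<forall>t\<ge>0. p t \<in> interior_simplex"
    and "heat_solution adj p"
  shows "\<exists>N' N''. \<forall>t\<ge>0.
           ((\<lambda>s. entropy_power m U (p s)) has_real_derivative N' t) (at t within {0..}) \<and>
           (N' has_real_derivative N'' t) (at t within {0..}) \<and>
           N'' t \<le> 0"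
proof -
  interpret strictly_convex_energy adj U
    using assms by unfold_locales
  define L where "L t = laplacian adj (($) (p t))" for t
  define G1 where "G1 t = 2 * (\<Sum>i\<in>UNIV. deriv U (p t $ i) * L t i)" for t
  define G2 where "G2 t = Gamma2 adj U (p t) (grad_energy U (p t))" for t
  define N where "N t = entropy_power m U (p t)" for t
  have pos: "0 < p t $ i" if "0 \<le> t" for t i
    using assms(7) that by (auto simp: interior_simplex_def)
  have G1: "Gamma1 adj U (p t) (grad_energy U (p t)) = G1 t" if "0 \<le> t" for t
    using Gamma1_grad_energy pos[OF that] by (simp add: G1_def L_def)
  have dp: "((\<lambda>s. p s $ i) has_real_derivative - (1 / 2) * L t i) (at t within {0..})"
    if "0 \<le> t" for t i
  proof -
    have "(\<Sum>j | adj i j. p t $ j - p t $ i) = (\<Sum>j\<in>UNIV. if adj i j then p t $ j - p t $ i else 0)"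
      by (simp add: sum.If_cases)
    also have "\<dots> = - L t i"
      unfolding L_def laplacian_def sum_negf[symmetric] by (intro sum.cong) auto
    finally have "1 / 2 * (\<Sum>j | adj i j. p t $ j - p t $ i) = - (1 / 2) * L t i"
      by simp
    then show ?thesis
      using assms(8) that unfolding heat_solution_def by metis
  qed
  have dL: "((\<lambda>s. L s i) has_real_derivative - (1 / 2) * laplacian adj (L t) i) (at t within {0..})"
    if "0 \<le> t" for t i
    \<comment> \<open>Moving -1/2 inside the Laplacian gives the goal the shape of a termwise
      derivative.\<close>
    unfolding laplacian_scale[symmetric]
    unfolding L_def laplacian_def[of _ "($) (p _)"] unfolding laplacian_def[of _ "\<lambda>i. - (1 / 2) * _ i"]
    using dp[OF that, unfolded L_def laplacian_def]
    by (intro DERIV_sum DERIV_cmult DERIV_diff)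
  have dN: "(N has_real_derivative N t * (G1 t / (2 * m))) (at t within {0..})"
    if "0 \<le> t" for t
  proof -
    have "((\<lambda>s. energy U (p s)) has_real_derivative
        (\<Sum>i\<in>UNIV. deriv U (p t $ i) * (- (1 / 2) * L t i))) (at t within {0..})"
      unfolding energy_def
      by (intro DERIV_sum DERIV_chain2[OF DERIV_U] pos dp that)
    moreover have "(\<Sum>i\<in>UNIV. deriv U (p t $ i) * (- (1 / 2) * L t i)) = - (G1 t / 4)"
      by (simp add: G1_def sum_negf sum_divide_distrib)
    ultimately have "((\<lambda>s. energy U (p s)) has_real_derivative - (G1 t / 4)) (at t within {0..})"
      by simp
    \<comment> \<open>The factor G1 / (2 m) is -2/m times E' = -G1/4.\<close>
    from DERIV_chain2[OF DERIV_exp DERIV_cmult[OF this, of "- (2 / m)"]] show ?thesis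
      using assms(5) unfolding N_def entropy_power_def by (simp add: field_simps)
  qed
  have dG1: "(G1 has_real_derivative - 2 * G2 t) (at t within {0..})" if "0 \<le> t" for t
  proof -
    have "(G1 has_real_derivative 2 * (\<Sum>i\<in>UNIV.
        deriv (deriv U) (p t $ i) * (- (1 / 2) * L t i) * L t i
          + - (1 / 2) * laplacian adj (L t) i * deriv U (p t $ i))) (at t within {0..})"
      unfolding G1_def
      by (intro DERIV_cmult DERIV_sum DERIV_mult DERIV_chain2[OF DERIV_deriv_U] pos dp dL that)
    moreover have "2 * G2 t = (\<Sum>i\<in>UNIV. deriv U (p t $ i) * laplacian adj (L t) i)
        + (\<Sum>i\<in>UNIV. deriv (deriv U) (p t $ i) * (L t i)\<^sup>2)"
      \<comment> \<open>Self-adjointness rewrites \<langle>L f, L p\<rangle> as \<langle>f, L (L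
        p)\<rangle>, the form in which the product rule yields it.\<close>
      using Gamma2_grad_energy[OF pos[OF that]]
        laplacian_selfadjoint[OF symp_adj, of "\<lambda>i. deriv U (p t $ i)" "L t"]
      by (simp add: G2_def L_def mult.commute)
    then have "2 * (\<Sum>i\<in>UNIV.
        deriv (deriv U) (p t $ i) * (- (1 / 2) * L t i) * L t i
          + - (1 / 2) * laplacian adj (L t) i * deriv U (p t $ i)) = - 2 * G2 t"
      by (simp add: sum.distrib sum_subtractf sum_negf sum_distrib_left power2_eq_square mult_ac)
    ultimately show ?thesis
      by simp
  qed
  have curvature: "(G1 t)\<^sup>2 / m \<le> G2 t" and G2_nonneg: "0 \<le> G2 t" if "0 \<le> t" for t
  proof -
    show *: "(G1 t)\<^sup>2 / m \<le> G2 t"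
    proof (cases "G1 t = 0")
      case True
      \<comment> \<open>Such a point lies outside \<open>Gamma_ratio_dom\<close>, so the minimum
        gives no bound; both sides are zero instead.\<close>
      then have "L t i = 0" for i
        using laplacian_eq_0_if_Gamma1_eq_0[OF pos[OF that]] G1[OF that] by (simp add: L_def)
      then have "G2 t = 0"
        using Gamma2_grad_energy[OF pos[OF that]] by (simp add: G2_def L_def)
      with True show ?thesis
        by simp
    next
      case False
      \<comment> \<open>At an interior point the quotient itself is an admissible value, with no
        boundary limit involved.\<close>
      have "p t \<in> interior_simplex" "p t \<in> prob_simplex"
        using assms(7) that by (auto simp: interior_simplex_def prob_simplex_def less_imp_le)
      then have "1 / m \<le> Gamma_ratio adj U (p t)"
        using assms(6) False G1[OF that]
        by (auto simp: is_min_Gamma_ratio_def has_Gamma_ratio_def Gamma_ratio_dom_def)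
      then show ?thesis
        using False assms(5) by (simp add: Gamma_ratio_def G1[OF that] G2_def field_simps)
    qed
    have "0 \<le> (G1 t)\<^sup>2 / m"
      using assms(5) by simp
    with * show "0 \<le> G2 t"
      by linarith
  qed
  have "(N has_real_derivative N t * (G1 t / (2 * m))) (at t within {0..}) \<and>
      ((\<lambda>s. N s * (G1 s / (2 * m))) has_real_derivative
        N t * (((G1 t)\<^sup>2 / m - 4 * G2 t) / (4 * m))) (at t within {0..}) \<and>
      N t * (((G1 t)\<^sup>2 / m - 4 * G2 t) / (4 * m)) \<le> 0" if "0 \<le> t" for t
  proof (intro conjI dN that)
    \<comment> \<open>The product rule gives N (G1 / (2 m))^2 - N G2 / m.\<close>
    show "((\<lambda>s. N s * (G1 s / (2 * m))) has_real_derivative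
        N t * (((G1 t)\<^sup>2 / m - 4 * G2 t) / (4 * m))) (at t within {0..})"
      using DERIV_mult[OF dN[OF that] DERIV_cdivide[OF dG1[OF that], of "2 * m"]]
      by (rule DERIV_cong) (use assms(5) in \<open>simp add: field_simps power2_eq_square\<close>)
    have "0 \<le> N t"
      by (simp add: N_def entropy_power_def)
    \<comment> \<open>\<open>curvature\<close> bounds the first term by one G2;
      \<open>G2_nonneg\<close> passes from G2 to 4 G2.\<close>
    then show "N t * (((G1 t)\<^sup>2 / m - 4 * G2 t) / (4 * m)) \<le> 0"
      using curvature[OF that] G2_nonneg[OF that] assms(5)
      by (intro mult_nonneg_nonpos divide_nonpos_pos) auto
  qed
  then show ?thesis
    unfolding N_def
    by (intro exI[of _ "\<lambda>t. entropy_power m U (p t) * (G1 t / (2 * m))"]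
        exI[of _ "\<lambda>t. entropy_power m U (p t) * (((G1 t)\<^sup>2 / m - 4 * G2 t) / (4 * m))"]) simp
qed

end
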